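(* Let $n\ge1$. A segmented permutation of $[n]$ is a permutation $\sigma=\sigma_1\cdots\sigma_n$ of $[n]$ together with a choice, for each slot between consecutive letters $\sigma_i,\sigma_{i+1}$ ($1\le i\le n-1$), of whether a bar is placed there; let $\mathcal{SP}_n$ be the set of these. Let $\mathrm{des}(\sigma)$ be the number of $i\in[n-1]$ with $\sigma_i>\sigma_{i+1}$ and no bar between $\sigma_i$ and $\sigma_{i+1}$, and $\mathrm{seg}(\sigma)$ the number of bars. Then the bivariate polynomial $$\alpha_n(t,q)=\sum_{\sigma\in\mathcal{SP}_n}t^{\mathrm{des}(\sigma)}q^{\mathrm{seg}(\sigma)}$$ is stable, i.e. $\alpha_n(t,q)\neq0$ whenever $\mathrm{Im}(t)>0$ and $\mathrm{Im}(q)>0$. *)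

theory Defs
  imports Complex_Main "HOL-Combinatorics.Permutations"
begin

text \<open>A segmented permutation of \<open>{1..n}\<close> is a pair \<open>(\<sigma>, B)\<close>, where \<open>i \<in> B\<close> means that there is a
  bar in the slot between \<open>\<sigma> i\<close> and \<open>\<sigma> (i + 1)\<close>.\<close>

definition segmented_permutations :: "nat \<Rightarrow> ((nat \<Rightarrow> nat) \<times> nat set) set" where
  "segmented_permutations n = {(\<sigma>, B). \<sigma> permutes {1..n} \<and> B \<subseteq> {1..<n}}"

definition des :: "nat \<Rightarrow> (nat \<Rightarrow> nat) \<times> nat set \<Rightarrow> nat" where
  "des n = (\<lambda>(\<sigma>, B). card {i \<in> {1..<n}. \<sigma> i > \<sigma> (i + 1) \<and> i \<notin> B})"

definition seg :: "(nat \<Rightarrow> nat) \<times> nat set \<Rightarrow> nat" where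
  "seg = (\<lambda>(\<sigma>, B). card B)"

definition seg_eulerian :: "nat \<Rightarrow> complex \<Rightarrow> complex \<Rightarrow> complex" where
  "seg_eulerian n t q = (\<Sum>s\<in>segmented_permutations n. t ^ des n s * q ^ seg s)"

definition stable2 :: "(complex \<Rightarrow> complex \<Rightarrow> complex) \<Rightarrow> bool" where
  "stable2 f \<longleftrightarrow> (\<forall>t q. Im t > 0 \<longrightarrow> Im q > 0 \<longrightarrow> f t q \<noteq> 0)"

lemma finite_segmented_permutations: "finite (segmented_permutations n)"
proof (rule finite_subset)
  show "segmented_permutations n \<subseteq> {\<sigma>. \<sigma> permutes {1..n}} \<times> Pow {1..<n}"
    by (auto simp: segmented_permutations_def)
qed (simp add: finite_permutations)

end

theory Submission
  imports Defs "HOL-Computational_Algebra.Fundamental_Theorem_Algebra"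
begin

text \<open>Summing over the bars first turns every descent into a factor \<open>t + q\<close> and every ascent into a
  factor \<open>1 + q\<close>, so \<open>\<alpha>\<^sub>n(t, q) = (1 + q)\<^sup>n\<^sup>-\<^sup>1 A\<^sub>n((t + q) / (1 + q))\<close> with the Eulerian polynomial \<open>A\<^sub>n\<close>.
  All complex roots of \<open>A\<^sub>n\<close> are real and nonpositive, and if \<open>t + q = c (1 + q)\<close> with \<open>c \<le> 0\<close>
  then \<open>Im t\<close> and \<open>Im q\<close> cannot both be positive. The location of the roots follows by induction from
  \<open>A\<^sub>n\<^sub>+\<^sub>1 = (1 + n x) A\<^sub>n + x (1 - x) A\<^sub>n'\<close>: if \<open>A\<^sub>n\<close> has the roots \<open>r\<^sub>i\<close>, then
  \<open>A\<^sub>n\<^sub>+\<^sub>1 / (x A\<^sub>n) = 1 / x + 1 + \<Sum>\<^sub>i (1 - r\<^sub>i) / (x - r\<^sub>i)\<close>, whose imaginary part has the sign opposite to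
  that of \<open>Im x\<close>, and which is positive for \<open>x > 0\<close>.\<close>

section \<open>Eulerian polynomials\<close>

definition descents :: "nat \<Rightarrow> (nat \<Rightarrow> nat) \<Rightarrow> nat set" where
  "descents n \<sigma> = {i \<in> {1..<n}. \<sigma> i > \<sigma> (i + 1)}"

definition eulerian_poly :: "nat \<Rightarrow> complex poly" where
  "eulerian_poly n = (\<Sum>\<sigma> | \<sigma> permutes {1..n}. monom 1 (card (descents n \<sigma>)))"

text \<open>The last branch fixes every point beyond \<open>n + 1\<close>, as
  \<open>permutes\<close> demands; for \<open>j >= 1\<close> the point 0 is handled by the first
  branch.\<close>

definition insert_max :: "nat \<Rightarrow> (nat \<Rightarrow> nat) \<Rightarrow> nat \<Rightarrow> nat \<Rightarrow> nat" where
  "insert_max n \<sigma> j i =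
    (if i < j then \<sigma> i else if i = j then n + 1 else if i \<le> n + 1 then \<sigma> (i - 1) else i)"

lemma finite_descents [simp]: "finite (descents n \<sigma>)"
  by (simp add: descents_def)

lemma card_descents_le: "card (descents n \<sigma>) \<le> n - 1"
proof -
  have "card (descents n \<sigma>) \<le> card {1..<n}"
    by (rule card_mono) (auto simp: descents_def)
  thus ?thesis by simp
qed

section \<open>Insertion of the largest letter\<close>

lemma insert_max_permutes:
  assumes \<sigma>: "\<sigma> permutes {1..n}" and j: "j \<in> {1..n + 1}"
  shows "insert_max n \<sigma> j permutes {1..n + 1}"
proof (rule inj_imp_permutes)
  have inj: "\<sigma> a = \<sigma> b \<longleftrightarrow> a = b" for a b
    using permutes_inj[OF \<sigma>] by (auto dest: injD)
  have im: "\<sigma> i \<in> {1..n}" if "i \<in> {1..n}" for i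
    using permutes_in_image[OF \<sigma>] that by blast
  have le: "\<sigma> i \<le> n" if "1 \<le> i" "i \<le> n" for i
    using im[of i] that by auto
  \<comment> \<open>Positions \<open>a < Suc b\<close> in cases around \<open>j\<close>: the letter
    \<open>n + 1\<close> exceeds all values of \<open>\<sigma>\<close>, and otherwise injectivity of
    \<open>\<sigma>\<close> decides.\<close>
  have ne: "insert_max n \<sigma> j a \<noteq> insert_max n \<sigma> j (Suc b)" if "1 \<le> a" "a \<le> b" "b \<le> n" for a b
  proof -
    have "\<sigma> a \<le> n" "\<sigma> b \<le> n" using that le by auto
    thus ?thesis using that j by (auto simp: insert_max_def inj)
  qed
  show "inj_on (insert_max n \<sigma> j) {1..n + 1}"
  proof (rule linorder_inj_onI)
    fix a b assume "a < b" "a \<in> {1..n + 1}" "b \<in> {1..n + 1}"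
    thus "insert_max n \<sigma> j a \<noteq> insert_max n \<sigma> j b"
      using ne[of a "b - 1"] by simp
  qed auto
  show "insert_max n \<sigma> j i \<in> {1..n + 1}" if i: "i \<in> {1..n + 1}" for i
  proof -
    consider "i < j" "i \<in> {1..n}" | "i = j" | "i > j" "i - 1 \<in> {1..n}"
      using i j by fastforce
    thus ?thesis
    proof cases
      case 1
      thus ?thesis using im[of i] by (simp add: insert_max_def)
    next
      case 2
      thus ?thesis by (simp add: insert_max_def)
    next
      case 3
      thus ?thesis using im[of "i - 1"] i by (simp add: insert_max_def)
    qed
  qed
  show "insert_max n \<sigma> j i = i" if "i \<notin> {1..n + 1}" for i
    using that j permutes_not_in[OF \<sigma>] by (auto simp: insert_max_def)
qed auto

lemma insert_max_inject:
  assumes \<sigma>: "\<sigma> permutes {1..n}" and \<tau>: "\<tau> permutes {1..n}"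
    and j: "j \<in> {1..n + 1}" and k: "k \<in> {1..n + 1}"
    and eq: "insert_max n \<sigma> j = insert_max n \<tau> k"
  shows "\<sigma> = \<tau> \<and> j = k"
proof -
  \<comment> \<open>The position of the letter \<open>n + 1\<close> recovers
    \<open>j\<close>.\<close>
  have "insert_max n \<sigma> j j = n + 1" "insert_max n \<tau> k k = n + 1"
    by (simp_all add: insert_max_def)
  hence "insert_max n \<sigma> j j = insert_max n \<sigma> j k"
    by (simp add: eq)
  hence [simp]: "k = j"
    using permutes_inj[OF insert_max_permutes[OF \<sigma> j]] by (auto dest: injD)
  have "\<sigma> i = \<tau> i" for i
  proof (cases "i \<in> {1..n}")
    case True
    show ?thesis
    proof (cases "i < j")
      case True
      thus ?thesis using fun_cong[OF eq, of i] by (simp add: insert_max_def)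
    next
      case False
      thus ?thesis using \<open>i \<in> {1..n}\<close> fun_cong[OF eq, of "i + 1"] by (simp add: insert_max_def)
    qed
  next
    case False
    thus ?thesis using permutes_not_in[OF \<sigma>] permutes_not_in[OF \<tau>] by simp
  qed
  thus ?thesis by auto
qed

lemma bij_betw_insert_max:
  "bij_betw (\<lambda>(\<sigma>, j). insert_max n \<sigma> j) ({\<sigma>. \<sigma> permutes {1..n}} \<times> {1..n + 1})
     {\<sigma>. \<sigma> permutes {1..n + 1}}"
    (is "bij_betw ?f ?A ?B")
proof -
  have inj: "inj_on ?f ?A"
  proof (rule inj_onI)
    fix x y assume "x \<in> ?A" "y \<in> ?A" "?f x = ?f y"
    thus "x = y"
      using insert_max_inject[of "fst x" n "fst y" "snd x" "snd y"]
      by (auto simp: case_prod_unfold prod_eq_iff)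
  qed
  \<comment> \<open>Surjectivity by counting: \<open>n! * (n + 1) = (n + 1)!\<close>.\<close>
  have "?f ` ?A = ?B"
  proof (rule card_subset_eq)
    show "?f ` ?A \<subseteq> ?B"
      using insert_max_permutes by auto
    show "finite ?B"
      by (simp add: finite_permutations)
    show "card (?f ` ?A) = card ?B"
      unfolding card_image[OF inj] by (simp add: card_cartesian_product card_permutations)
  qed
  with inj show ?thesis by (simp add: bij_betw_def)
qed

text \<open>The new maximum starts a descent at \<open>j\<close> unless it stands last, and it turns
  slot \<open>j - 1\<close> into an ascent, destroying a descent there. All other comparisons
  survive.\<close>

lemma card_descents_insert_max:
  assumes \<sigma>: "\<sigma> permutes {1..n}" and j: "j \<in> {1..n + 1}"
  shows "card (descents (n + 1) (insert_max n \<sigma> j)) =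
    (if j = n + 1 \<or> j - 1 \<in> descents n \<sigma> then card (descents n \<sigma>) else card (descents n \<sigma>) + 1)"
proof -
  define D where "D = descents n \<sigma>"
  \<comment> \<open>New index of an old slot: those from \<open>j\<close> on shift by one. The split
    slot \<open>j - 1\<close> is treated separately.\<close>
  define s where "s i = (if i < j then i else i + 1)" for i
  have le: "\<sigma> i \<le> n" if "1 \<le> i" "i \<le> n" for i
    using permutes_in_image[OF \<sigma>, of i] that by auto
  have "descents (n + 1) (insert_max n \<sigma> j) = s ` (D - {j - 1}) \<union> (if j \<le> n then {j} else {})"
    (is "?L = ?R")
  proof (rule set_eqI)
    fix i
    consider "i < j" "i \<noteq> j - 1" | "i < j" "i = j - 1" | "i = j" | "i > j" by linarith
    thus "i \<in> ?L \<longleftrightarrow> i \<in> ?R"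
    proof cases
      case 1
      thus ?thesis using j
        by (auto simp: descents_def D_def s_def insert_max_def image_iff)
    next
      case 2
      thus ?thesis using j le[of i]
        by (auto simp: descents_def D_def s_def insert_max_def image_iff)
    next
      case 3
      thus ?thesis using j le[of i]
        by (auto simp: descents_def D_def s_def insert_max_def image_iff)
    next
      case 4
      then obtain k where k: "i = Suc k" "k \<ge> j" by (cases i) auto
      have "i \<in> ?R \<longleftrightarrow> k \<in> D"
        using k j by (auto simp: s_def image_iff)
      also have "\<dots> \<longleftrightarrow> i \<in> ?L"
        using k j by (auto simp: D_def descents_def insert_max_def)
      finally show ?thesis by simp
    qed
  qed
  moreover have "j \<notin> s ` (D - {j - 1})"
    by (auto simp: s_def)
  moreover have "card (s ` (D - {j - 1})) = card (D - {j - 1})"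
    by (rule card_image) (auto intro!: inj_onI simp: s_def split: if_splits)
  \<comment> \<open>Positivity matters for truncated subtraction: one descent lost and one gained
    must give back \<open>card D\<close>.\<close>
  moreover have "finite D" "n \<notin> D" "card D > 0" if "j - 1 \<in> D"
    using that by (auto simp: D_def descents_def card_gt_0_iff)
  moreover have "j \<le> n" if "j - 1 \<in> D"
    using that by (auto simp: D_def descents_def)
  ultimately show ?thesis
    using j by (auto simp: D_def[symmetric] card_insert_if card_Diff_singleton_if)
       (auto simp: D_def)
qed

text \<open>With \<open>d\<close> descents, \<open>d + 1\<close> insertions keep \<open>d\<close>
  and the other \<open>n - d\<close> raise it. The total
  \<open>(d + 1) x^d + (n - d) x^(d+1)\<close> equals
  \<open>(1 + n x) x^d + x (1 - x) d x^(d-1)\<close>.\<close>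

lemma sum_insert_max_descents:
  assumes \<sigma>: "\<sigma> permutes {1..n}" and n: "n \<ge> 1"
  shows "(\<Sum>j\<in>{1..n + 1}. monom (1 :: complex) (card (descents (n + 1) (insert_max n \<sigma> j)))) =
    (1 + of_nat n * [:0, 1:]) * monom 1 (card (descents n \<sigma>))
      + [:0, 1, -1:] * pderiv (monom 1 (card (descents n \<sigma>)))"
proof -
  define D d where "D = descents n \<sigma>" and "d = card D"
  have dn: "d \<le> n"
    using card_descents_le[of n \<sigma>] n by (simp add: d_def D_def)
  \<comment> \<open>Positions that create no new descent: the end, and the place right after a
    descent top.\<close>
  define S where "S = insert (n + 1) (Suc ` D)"
  have fin: "finite D" "finite S" by (auto simp: S_def D_def)
  have S: "S \<subseteq> {1..n + 1}" by (auto simp: S_def D_def descents_def)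
  have cS: "card S = d + 1"
    by (simp add: S_def fin card_insert_if card_image d_def) (auto simp: D_def descents_def)
  have cR: "card ({1..n + 1} - S) = n - d"
    using card_Diff_subset[OF fin(2) S] cS by simp
  have iff: "j = n + 1 \<or> j - 1 \<in> D \<longleftrightarrow> j \<in> S" if "j \<in> {1..n + 1}" for j
    using that by (cases j) (auto simp: S_def)
  have "(\<Sum>j\<in>{1..n + 1}. monom (1 :: complex) (card (descents (n + 1) (insert_max n \<sigma> j)))) =
        (\<Sum>j\<in>{1..n + 1}. if j \<in> S then monom 1 d else monom 1 (d + 1))"
    by (rule sum.cong[OF refl], subst card_descents_insert_max[OF \<sigma>])
       (use iff in \<open>auto simp: D_def d_def\<close>)
  also have "\<dots> = (\<Sum>j\<in>S. monom 1 d) + (\<Sum>j\<in>{1..n + 1} - S. monom 1 (d + 1))"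
    by (subst sum.subset_diff[OF S]) (auto simp: add.commute)
  also have "\<dots> = of_nat (d + 1) * monom 1 d + of_nat (n - d) * monom 1 (d + 1)"
    by (simp only: sum_constant cS cR)
  also have "\<dots> = (1 + of_nat n * [:0, 1:]) * monom 1 d + [:0, 1, -1:] * pderiv (monom 1 d)"
    using dn by (cases d)
      (auto simp: poly_eq_poly_eq_iff[symmetric] fun_eq_iff poly_monom pderiv_monom
         algebra_simps)
  finally show ?thesis by (simp add: D_def d_def)
qed

section \<open>Recurrence, degree and leading coefficient\<close>

lemma eulerian_poly_1: "eulerian_poly (Suc 0) = 1"
proof -
  have "descents (Suc 0) \<sigma> = {}" for \<sigma> by (auto simp: descents_def)
  thus ?thesis by (simp add: eulerian_poly_def)
qed

lemma eulerian_poly_Suc: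
  assumes "n \<ge> 1"
  shows "eulerian_poly (Suc n) =
    (1 + of_nat n * [:0, 1:]) * eulerian_poly n + [:0, 1, -1:] * pderiv (eulerian_poly n)"
proof -
  have "eulerian_poly (Suc n) =
      (\<Sum>(\<sigma>, j)\<in>{\<sigma>. \<sigma> permutes {1..n}} \<times> {1..n + 1}.
         monom 1 (card (descents (n + 1) (insert_max n \<sigma> j))))"
    unfolding eulerian_poly_def
    using sum.reindex_bij_betw[OF bij_betw_insert_max[of n],
        of "\<lambda>\<sigma>. monom (1 :: complex) (card (descents (n + 1) \<sigma>))"]
    by (simp add: case_prod_unfold)
  also have "\<dots> = (\<Sum>\<sigma> | \<sigma> permutes {1..n}. \<Sum>j\<in>{1..n + 1}.
         monom 1 (card (descents (n + 1) (insert_max n \<sigma> j))))"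
    by (rule sum.cartesian_product[symmetric])
  also have "\<dots> = (\<Sum>\<sigma> | \<sigma> permutes {1..n}. (1 + of_nat n * [:0, 1:]) * monom 1 (card (descents n \<sigma>))
      + [:0, 1, -1:] * pderiv (monom 1 (card (descents n \<sigma>))))"
    by (intro sum.cong refl sum_insert_max_descents) (use assms in auto)
  also have "\<dots> = (1 + of_nat n * [:0, 1:]) * eulerian_poly n + [:0, 1, -1:] * pderiv (eulerian_poly n)"
    by (simp only: sum.distrib sum_distrib_left eulerian_poly_def
        higher_pderiv_sum[of "Suc 0", simplified])
  finally show ?thesis .
qed

lemma degree_eulerian_poly_le: "degree (eulerian_poly n) \<le> n - 1"
  unfolding eulerian_poly_def
  by (intro degree_sum_le) (use card_descents_le[of n] in \<open>auto simp: finite_permutations degree_monom_eq\<close>)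

text \<open>In the recurrence, \<open>n x p\<close> contributes \<open>n\<close> to the top
  coefficient and \<open>- x^2 p'\<close> contributes \<open>-(n - 1)\<close>. This yields the exact
  degree and non-vanishing used for the roots.\<close>

lemma coeff_eulerian_poly: "n \<ge> 1 \<Longrightarrow> coeff (eulerian_poly n) (n - 1) = 1"
proof (induction n rule: dec_induct)
  case base
  show ?case by (simp add: eulerian_poly_1)
next
  case (step n)
  then obtain m where m: "n = Suc m" by (cases n) auto
  define p where "p = eulerian_poly n"
  have 0: "coeff p (Suc m) = 0"
    using degree_eulerian_poly_le[of n] by (intro coeff_eq_0) (auto simp: m p_def)
  have 1: "coeff p m = 1" using step.IH by (simp add: m p_def)
  have 2: "coeff (pCons 0 (pderiv p)) m = of_nat m * coeff p m"
    by (cases m) (simp_all add: coeff_pderiv)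
  have "eulerian_poly (Suc n) =
      p + smult (of_nat n) (pCons 0 p) + pCons 0 (pderiv p - pCons 0 (pderiv p))"
    using eulerian_poly_Suc[OF step.hyps(1)]
    by (simp add: p_def[symmetric] of_nat_poly algebra_simps)
  thus ?case
    by (simp add: m 0 1 2 coeff_pderiv)
qed

lemma degree_eulerian_poly:
  assumes "n \<ge> 1"
  shows "degree (eulerian_poly n) = n - 1"
  using le_degree[of "eulerian_poly n" "n - 1"] coeff_eulerian_poly[OF assms]
    degree_eulerian_poly_le[of n] by simp

section \<open>Location of the roots\<close>

definition nonpos_real :: "complex \<Rightarrow> bool" where
  "nonpos_real z \<longleftrightarrow> Im z = 0 \<and> Re z \<le> 0"

text \<open>Adding a root \<open>r\<close> to \<open>p\<close> adds \<open>1 + (1 - z) / (z - r) = (1 - r) / (z - r)\<close> to the expression below.\<close>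

lemma log_deriv_of_nonpos_rooted:
  fixes p :: "complex poly"
  assumes "p \<noteq> 0" "\<And>r. poly p r = 0 \<Longrightarrow> nonpos_real r" and z: "\<not> nonpos_real z"
  shows "let f = of_nat (degree p) + (1 - z) * poly (pderiv p) z / poly p z
    in Im z * Im f \<le> 0 \<and> (Im z = 0 \<longrightarrow> Re f \<ge> 0)"
  using assms(1,2)
proof (induction "degree p" arbitrary: p)
  case 0
  then obtain c where "p = [:c:]" by (metis degree_eq_zeroE)
  thus ?case by (simp add: Let_def)
next
  case (Suc d)
  have "\<not> constant (poly p)"
    using Suc.hyps(2) by (simp add: constant_degree)
  then obtain r where r: "poly p r = 0"
    using fundamental_theorem_of_algebra by blast
  then obtain s where s: "p = [:-r, 1:] * s"
    by (auto simp: poly_eq_0_iff_dvd)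
  have [simp]: "s \<noteq> 0" using s Suc.prems(1) by auto
  have deg: "degree p = Suc (degree s)"
    unfolding s by (subst degree_mult_eq) auto
  define f where "f = of_nat (degree s) + (1 - z) * poly (pderiv s) z / poly s z"
  have f: "Im z * Im f \<le> 0 \<and> (Im z = 0 \<longrightarrow> Re f \<ge> 0)"
    using Suc.hyps(1)[of s] deg Suc.hyps(2) Suc.prems(2) by (simp add: f_def Let_def s)
  have rr: "Im r = 0" "Re r \<le> 0"
    using Suc.prems(2)[OF r] by (auto simp: nonpos_real_def)
  have zr: "z \<noteq> r" using rr z by (auto simp: nonpos_real_def)
  have sz: "poly s z \<noteq> 0"
    using Suc.prems(2)[of z] z by (auto simp: s)
  define g where "g = (1 - r) / (z - r)"
  have "of_nat (degree p) + (1 - z) * poly (pderiv p) z / poly p z = f + g"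
  proof -
    have 1: "poly p z = (z - r) * poly s z"
      by (simp add: s algebra_simps)
    have 2: "poly (pderiv p) z = poly s z + (z - r) * poly (pderiv s) z"
      unfolding s pderiv_mult by (simp add: pderiv_pCons algebra_simps)
    show ?thesis
      unfolding deg 1 2 f_def g_def using zr sz by (simp add: field_simps)
  qed
  \<comment> \<open>As \<open>r\<close> is real with \<open>1 - r > 0\<close>, \<open>g\<close> is a
    positive multiple of the conjugate of \<open>z - r\<close>.\<close>
  moreover have "Im z * Im g \<le> 0"
  proof -
    have "Im z * Im g = - ((1 - Re r) * (Im z)\<^sup>2 / ((Re z - Re r)\<^sup>2 + (Im z)\<^sup>2))"
      using rr by (simp add: g_def Im_divide power2_eq_square)
    thus ?thesis using rr by simp
  qed
  moreover have "Re g \<ge> 0" if "Im z = 0"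
  proof -
    have "Re z > 0" using that z by (auto simp: nonpos_real_def)
    thus ?thesis using rr that by (simp add: g_def Re_divide)
  qed
  ultimately show ?case
    using f by (auto simp: Let_def algebra_simps)
qed

lemma eulerian_poly_roots_nonpos:
  assumes "n \<ge> 1" "poly (eulerian_poly n) z = 0"
  shows "nonpos_real z"
  using assms
proof (induction n arbitrary: z rule: dec_induct)
  case base
  thus ?case by (simp add: eulerian_poly_1)
next
  case (step n)
  define p where "p = eulerian_poly n"
  show ?case
  proof (rule ccontr)
    assume z: "\<not> nonpos_real z"
    have "p \<noteq> 0"
      using coeff_eulerian_poly[of n] step by (auto simp: p_def)
    define f where "f = of_nat (degree p) + (1 - z) * poly (pderiv p) z / poly p z"
    have f: "Im z * Im f \<le> 0" "Im z = 0 \<Longrightarrow> Re f \<ge> 0"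
      using log_deriv_of_nonpos_rooted[OF \<open>p \<noteq> 0\<close> _ z] step.IH
      by (auto simp: f_def p_def Let_def)
    have pz: "poly p z \<noteq> 0" using step.IH z by (auto simp: p_def)
    have z0: "z \<noteq> 0" using z by (auto simp: nonpos_real_def)
    have deg: "of_nat (degree p) = (of_nat n - 1 :: complex)"
      using degree_eulerian_poly[of n] step by (simp add: p_def)
    have "0 = poly (eulerian_poly (Suc n)) z" using step by simp
    also have "\<dots> = (1 + of_nat n * z) * poly p z + z * (1 - z) * poly (pderiv p) z"
      using step by (simp add: eulerian_poly_Suc p_def algebra_simps)
    \<comment> \<open>Here \<open>n = 1 + degree p\<close>: the 1 stays visible, the degree is
      absorbed into \<open>f\<close>.\<close>
    also have "\<dots> = poly p z * z * (1 / z + 1 + f)"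
      using pz z0 by (simp add: f_def deg field_simps)
    finally have 0: "1 / z + 1 + f = 0" using pz z0 by simp
    show False
    proof (cases "Im z = 0")
      case True
      hence "Re z > 0" using z by (auto simp: nonpos_real_def)
      hence "Re (1 / z + 1 + f) > 0"
        using f(2) True by (simp add: Re_divide add_pos_nonneg)
      thus False using 0 by simp
    next
      case False
      \<comment> \<open>The bound on \<open>f\<close> is only weak; the term \<open>1 / z\<close>
        makes the inequality strict.\<close>
      have "Im z * Im (1 / z + 1 + f) = - ((Im z)\<^sup>2 / ((Re z)\<^sup>2 + (Im z)\<^sup>2)) + Im z * Im f"
        by (simp add: Im_divide power2_eq_square algebra_simps)
      moreover have "(Im z)\<^sup>2 / ((Re z)\<^sup>2 + (Im z)\<^sup>2) > 0"
        using False by (intro divide_pos_pos add_nonneg_pos) auto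
      ultimately show False using 0 f(1) by simp
    qed
  qed
qed

section \<open>Segmented permutations\<close>

lemma seg_eulerian_altdef:
  "seg_eulerian n t q = (\<Sum>\<sigma> | \<sigma> permutes {1..n}.
     (t + q) ^ card (descents n \<sigma>) * (1 + q) ^ (n - 1 - card (descents n \<sigma>)))"
proof -
  have "(\<Sum>B\<in>Pow {1..<n}. t ^ des n (\<sigma>, B) * q ^ seg (\<sigma>, B)) =
      (t + q) ^ card (descents n \<sigma>) * (1 + q) ^ (n - 1 - card (descents n \<sigma>))" for \<sigma>
  proof -
    define D where "D = descents n \<sigma>"
    have D: "D \<subseteq> {1..<n}" by (auto simp: D_def descents_def)
    have "(\<Sum>B\<in>Pow {1..<n}. t ^ des n (\<sigma>, B) * q ^ seg (\<sigma>, B)) =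
        (\<Sum>B\<in>Pow {1..<n}. (\<Prod>i\<in>B. q) * (\<Prod>i\<in>{1..<n} - B. if i \<in> D then t else 1))"
    proof (rule sum.cong[OF refl])
      fix B assume "B \<in> Pow {1..<n}"
      have "{i \<in> {1..<n}. \<sigma> (i + 1) < \<sigma> i \<and> i \<notin> B} = ({1..<n} - B) \<inter> D"
        by (auto simp: D_def descents_def)
      thus "t ^ des n (\<sigma>, B) * q ^ seg (\<sigma>, B) =
          (\<Prod>i\<in>B. q) * (\<Prod>i\<in>{1..<n} - B. if i \<in> D then t else 1)"
        by (simp add: des_def seg_def prod.inter_restrict[symmetric])
    qed
    \<comment> \<open>Expanding this product means choosing the set \<open>B\<close> of slots that
      contribute \<open>q\<close>.\<close>
    also have "\<dots> = (\<Prod>i\<in>{1..<n}. q + (if i \<in> D then t else 1))"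
      by (rule prod_add[symmetric]) simp
    also have "\<dots> = (\<Prod>i\<in>{1..<n} - D. 1 + q) * (\<Prod>i\<in>D. t + q)"
      by (subst prod.subset_diff[OF D]) (auto simp: add.commute)
    also have "\<dots> = (t + q) ^ card D * (1 + q) ^ (n - 1 - card D)"
      using D by (simp add: card_Diff_subset finite_subset[OF D])
    finally show ?thesis by (simp add: D_def)
  qed
  moreover have "segmented_permutations n = {\<sigma>. \<sigma> permutes {1..n}} \<times> Pow {1..<n}"
    by (auto simp: segmented_permutations_def)
  ultimately show ?thesis
    by (simp add: seg_eulerian_def sum.cartesian_product')
qed

lemma seg_eulerian_eq_eulerian_poly:
  assumes "1 + q \<noteq> 0"
  shows "seg_eulerian n t q = (1 + q) ^ (n - 1) * poly (eulerian_poly n) ((t + q) / (1 + q))"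
proof -
  have "(t + q) ^ d * (1 + q) ^ (n - 1 - d) = (1 + q) ^ (n - 1) * ((t + q) / (1 + q)) ^ d"
    if "d \<le> n - 1" for d
  proof -
    have "(1 + q) ^ (n - 1) = (1 + q) ^ d * (1 + q) ^ (n - 1 - d)"
      using that by (simp only: power_add[symmetric] le_add_diff_inverse)
    thus ?thesis using assms by (simp add: power_divide)
  qed
  from this[OF card_descents_le] show ?thesis
    by (simp add: seg_eulerian_altdef eulerian_poly_def poly_sum poly_monom sum_distrib_left)
qed

theorem theorem3p3:
  fixes n :: nat
  assumes "n \<ge> 1"
  shows "stable2 (seg_eulerian n)"
  unfolding stable2_def
proof (intro allI impI notI)
  fix t q :: complex
  assume t: "Im t > 0" and q: "Im q > 0" and zero: "seg_eulerian n t q = 0"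
  define c where "c = (t + q) / (1 + q)"
  have q1: "1 + q \<noteq> 0" using q by (auto simp: complex_eq_iff)
  hence "poly (eulerian_poly n) c = 0"
    using zero by (simp add: seg_eulerian_eq_eulerian_poly c_def)
  hence c: "Im c = 0" "Re c \<le> 0"
    using eulerian_poly_roots_nonpos[OF assms] by (auto simp: nonpos_real_def)
  have "t + q = c * (1 + q)" using q1 by (simp add: c_def)
  \<comment> \<open>Imaginary parts, with \<open>c\<close> real: the left side is positive, the
    right side is not.\<close>
  hence "Im t + Im q = Re c * Im q"
    using c by (simp add: complex_eq_iff)
  moreover have "Re c * Im q \<le> 0" using c q by (simp add: mult_nonpos_nonneg)
  ultimately show False using t q by simp
qed

end
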